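(* Let $I:=[0,1]$ and let $(\xi_n)_{n\in\mathbb{N}}$ be a sequence of independent and identically distributed $\{0,1\}$-valued random variables on a probability space $(\Omega,\mathcal{A},\mathbb{P})$ such that $\mathbb{P}(\xi_1=0)=q$ and $\mathbb{P}(\xi_1=1)=1-q$, where $q\in(0,1)$. For each $n\in\mathbb{N}$, let $M_n:\Omega\to\mathcal{M}_2$, $$(M_n(\omega))(x_1,x_2):=m_0(x_1,x_2)\,\mathbf{1}_{\{\xi_n(\omega)=0\}}+m_1(x_1,x_2)\,\mathbf{1}_{\{\xi_n(\omega)=1\}},\qquad \omega\in\Omega,\ x_1,x_2\in I,$$ where $m_0(x_1,x_2):=\frac{x_1+x_2}{2}$ and $m_1(x_1,x_2):=\sqrt{x_1x_2}$ for $x_1,x_2\in I$. Then for each $n\in\mathbb{N}$, $M_n$ is a random mean generated by $\xi_n$, and $$\mathbb{P}\Big(\big\{\omega\in\Omega:\lim_{n\to\infty}\kappa_n(\omega)=0\big\}\Big)=1,$$ where $$\kappa_n(\omega):=\sup_{x\in I^2}\Big|\frac1n\sum_{j=1}^n (M_j(\omega))(x)-(\mathbb{E}(M_1))(x)\Big|,\qquad \omega\in\Omega,$$ with $(\mathbb{E}(M_1))(x_1,x_2)=\frac{x_1+x_2}{2}\,q+\sqrt{x_1x_2}\,(1-q)$, $x_1,x_2\in I$. Further, as $n\to\infty$, $$\sqrt n\,\kappa_n\ \stackrel{\mathcal{D}}{\longrightarrow}\ \sup_{x_1,x_2\in[0,1]}\Big(\frac{x_1+x_2}{2}-\sqrt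{x_1x_2}\Big)\cdot|\mathcal{N}(0,q(1-q))|=\frac12\,|\mathcal{N}(0,q(1-q))|.$$
   Context: $\mathbb{N}$ is the set of positive integers. $\mathcal{B}(\cdot)$ denotes the Borel $\sigma$-algebra. $\mathcal{C}(I^p)$ is the Banach space of real-valued continuous functions on $I^p$ with the supremum norm. $\stackrel{\mathcal{D}}{\longrightarrow}$ denotes convergence in distribution, and $\mathcal{N}(0,\sigma^2)$ in the limit denotes a random variable with the normal distribution of mean $0$ and variance $\sigma^2$. $\mathcal{M}_p\subset\mathcal{C}(I^p)$ is the set of $p$-variable (continuous) means on $I$: those $m\in\mathcal{C}(I^p)$ with $\min(x)\le m(x)\le\max(x)$ for all $x\in I^p$, where $\min(x)$ and $\max(x)$ are the minimum and maximum of the coordinates of $x$. Here $p=2$. Definition (random mean generated by $\xi$). Let $\xi:\Omega\to\mathbb{R}^d$ be a random variable on $(\Omega,\mathcal{A},\mathbb{P})$. A map $M:\Omega\to\mathcal{M}_p$ is called a ($p$-variable, continuous) random mean (in $I$) generated by $\xi$ if: (i) $M$ is $(\mathcal{A},\mathcal{B}(\mathcal{C}(I^p)))$-measurable; and (ii) there is a $(\mathcal{B}(I^p)\times\mathcal{B}(\mathbb{R}^d),\mathcal{B}(I))$-measurable map $M_\xi:I^p\times\mathbb{R}^d\to I$ such that (a) for every $\omega\in\Omega$ the map $I^p\ni x\mapsto M_\xi(x,\xi(\omega))$ is in $\mathcal{C}(I^p)$, and (b) $\mathbb{P}(\{\omega\in\Omega:(M(\omega))(x)=M_\xi(x,\xi(\omega))\text{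 for every }x\in I^p\})=1$. Expected value. For such an $M$, $\mathbb{E}(M):=\int_\Omega M(\omega)\,\mathrm{d}\mathbb{P}(\omega)\in\mathcal{C}(I^p)$ is the Bochner integral of $M$ regarded as a map into $\mathcal{C}(I^p)$. *)

theory Defs
  imports "HOL-Probability.Probability"
begin

section \<open>The space of continuous functions on a compact metric space\<close>

text \<open>On a compact domain every continuous function is bounded, so the library type of bounded
  continuous functions with the supremum norm is the Banach space of all continuous functions.
  The Bochner integral of the library needs a second countable range, whence the instance below.\<close>

class compact_metric_space = metric_space +
  assumes compact_UNIV: "compact (UNIV :: 'a set)"

lemma bcontfun_compact_iff:
  "f \<in> bcontfun \<longleftrightarrow> continuous_on (UNIV :: 'a::compact_metric_space set) f"
  using compact_continuous_image[of UNIV f] compact_UNIV compact_imp_bounded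
  by (auto simp: bcontfun_def)

lemma bcontfun_separable:
  "\<exists>S :: ('a::compact_metric_space \<Rightarrow>\<^sub>C 'b::{metric_space, second_countable_topology}) set.
     countable S \<and> (\<forall>f e. 0 < e \<longrightarrow> (\<exists>g\<in>S. dist f g < e))"
proof -
  obtain D :: "'b set" where D: "countable D" "\<And>X. open X \<Longrightarrow> X \<noteq> {} \<Longrightarrow> \<exists>d\<in>D. d \<in> X"
    using countable_dense_exists by (metis (no_types, lifting))
  let ?\<delta> = "\<lambda>n. 1 / (real n + 1)"
  have "\<exists>ks :: 'a list. (\<Union>k\<in>set ks. ball k (?\<delta> n)) = UNIV" for n
  proof -
    have "\<exists>k. finite k \<and> (UNIV :: 'a set) \<subseteq> (\<Union>x\<in>k. ball x (?\<delta> n))"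
      using compact_UNIV[where 'a='a] by (auto simp: compact_eq_totally_bounded)
    then obtain k :: "'a set" where k: "finite k" "UNIV \<subseteq> (\<Union>x\<in>k. ball x (?\<delta> n))" by blast
    obtain ks where "set ks = k" using finite_list[OF k(1)] by blast
    then show ?thesis using k(2) by (intro exI[of _ ks]) auto
  qed
  then obtain ks :: "nat \<Rightarrow> 'a list" where ks: "\<And>n. (\<Union>k\<in>set (ks n). ball k (?\<delta> n)) = UNIV"
    by metis
  define Q where "Q = (\<lambda>(n, m, r) (f :: 'a \<Rightarrow>\<^sub>C 'b).
    \<forall>i < length (ks n). \<forall>x \<in> ball (ks n ! i) (?\<delta> n). dist (f x) (r ! i) < ?\<delta> m)"
  define S where "S = (\<lambda>t. SOME f. Q t f) ` (UNIV \<times> UNIV \<times> lists D)"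
  have "countable S"
    unfolding S_def using D(1) by (intro countable_image countable_SIGMA countable_lists) auto
  moreover have "\<exists>g\<in>S. dist f g < e" if e: "0 < e" for f e
  proof -
    obtain m where m: "?\<delta> m < e / 4"
      using reals_Archimedean[of "e / 4"] e by (auto simp: inverse_eq_divide add.commute)
    have "uniformly_continuous_on UNIV (apply_bcontfun f)"
      using compact_UNIV by (intro compact_uniformly_continuous) auto
    then obtain d where d: "0 < d" "\<And>x y. dist x y < d \<Longrightarrow> dist (f x) (f y) < ?\<delta> m / 2"
      unfolding uniformly_continuous_on_def by (metis UNIV_I half_gt_zero of_nat_0_le_iff
          zero_less_divide_1_iff add_nonneg_pos zero_less_one)
    obtain n where n: "?\<delta> n < d"
      using reals_Archimedean[OF d(1)] by (auto simp: inverse_eq_divide add.commute)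
    have "\<exists>v\<in>D. v \<in> ball (f x) (?\<delta> m / 2)" for x
      by (rule D(2)) (auto intro: add_nonneg_pos)
    then obtain v where v: "\<And>x. v x \<in> D" "\<And>x. dist (f x) (v x) < ?\<delta> m / 2"
      by (metis mem_ball)
    define r where "r = map v (ks n)"
    have Qf: "Q (n, m, r) f"
      unfolding Q_def
    proof (clarsimp)
      fix i x assume i: "i < length (ks n)" and x: "dist (ks n ! i) x < 1 / (real n + 1)"
      have "dist (f x) (f (ks n ! i)) < ?\<delta> m / 2"
        using d(2)[of x "ks n ! i"] x n by (simp add: dist_commute)
      moreover have "dist (f (ks n ! i)) (r ! i) < ?\<delta> m / 2"
        using v(2) i by (simp add: r_def)
      ultimately have "dist (f x) (f (ks n ! i)) + dist (f (ks n ! i)) (r ! i) < ?\<delta> m"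
        by linarith
      then show "dist (f x) (r ! i) < 1 / (real m + 1)"
        using dist_triangle[of "f x" "r ! i" "f (ks n ! i)"] by linarith
    qed
    define g where "g = (SOME f. Q (n, m, r) f)"
    have Qg: "Q (n, m, r) g" unfolding g_def by (rule someI[of _ f]) (rule Qf)
    have "r \<in> lists D" using v(1) by (auto simp: r_def)
    then have gS: "g \<in> S" unfolding S_def g_def by auto
    have "dist f g \<le> e / 2"
    proof (rule dist_bound)
      fix x
      have "x \<in> (\<Union>k\<in>set (ks n). ball k (?\<delta> n))" by (simp only: ks UNIV_I)
      then obtain i where i: "i < length (ks n)" "x \<in> ball (ks n ! i) (?\<delta> n)"
        by (metis UN_E in_set_conv_nth)
      have "dist (f x) (r ! i) < ?\<delta> m" "dist (g x) (r ! i) < ?\<delta> m"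
        using Qf Qg i unfolding Q_def by blast+
      then show "dist (f x) (g x) \<le> e / 2"
        using dist_triangle2[of "f x" "g x" "r ! i"] m by linarith
    qed
    then show ?thesis using gS e by (intro bexI[of _ g]) auto
  qed
  ultimately show ?thesis by blast
qed

instance bcontfun :: (compact_metric_space, "{metric_space, second_countable_topology}")
  second_countable_topology
proof
  obtain S :: "('a \<Rightarrow>\<^sub>C 'b) set"
    where S: "countable S" "\<And>f e. 0 < e \<Longrightarrow> \<exists>g\<in>S. dist f g < e"
    using bcontfun_separable by blast
  define B where "B = (\<lambda>(g, n). ball g (1 / (real n + 1))) ` (S \<times> UNIV)"
  have "topological_basis B"
  proof (rule topological_basisI)
    show "\<And>b. b \<in> B \<Longrightarrow> open b" by (auto simp: B_def)
    fix O' and f :: "'a \<Rightarrow>\<^sub>C 'b" assume "open O'" "f \<in> O'"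
    then obtain e where e: "0 < e" "ball f e \<subseteq> O'" by (auto simp: open_contains_ball)
    obtain n where n: "1 / (real n + 1) < e / 2"
      using reals_Archimedean[of "e / 2"] e by (auto simp: inverse_eq_divide add.commute)
    obtain g where g: "g \<in> S" "dist f g < 1 / (real n + 1)"
      using S(2)[of "1 / (real n + 1)" f] by (auto intro: add_nonneg_pos)
    have "ball g (1 / (real n + 1)) \<subseteq> ball f e"
    proof
      fix h assume "h \<in> ball g (1 / (real n + 1))"
      then show "h \<in> ball f e"
        using dist_triangle[of f h g] g n by simp
    qed
    then show "\<exists>B'\<in>B. f \<in> B' \<and> B' \<subseteq> O'"
      using g e by (intro bexI[of _ "ball g (1 / (real n + 1))"]) (auto simp: B_def dist_commute)
  qed
  then have "open = generate_topology B" by (rule topological_basis_imp_subbasis)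
  moreover have "countable B" unfolding B_def using S(1) by auto
  ultimately show "\<exists>B::('a \<Rightarrow>\<^sub>C 'b) set set. countable B \<and> open = generate_topology B" by blast
qed

section \<open>The unit interval and its powers\<close>

typedef unit_interval = "{0..1 :: real}"
  morphisms real_of_ui ui_of_real
  by auto

setup_lifting type_definition_unit_interval

instantiation unit_interval :: metric_space
begin

lift_definition dist_unit_interval :: "unit_interval \<Rightarrow> unit_interval \<Rightarrow> real" is dist .

definition uniformity_unit_interval :: "(unit_interval \<times> unit_interval) filter"
  where "uniformity_unit_interval = (INF e\<in>{0 <..}. principal {(x, y). dist x y < e})"

definition open_unit_interval :: "unit_interval set \<Rightarrow> bool"
  where "open_unit_interval S = (\<forall>x\<in>S. \<forall>\<^sub>F (x', y) in uniformity. x' = x \<longrightarrow> y \<in> S)"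

instance
proof
  fix x y z :: unit_interval
  show "dist x y = 0 \<longleftrightarrow> x = y" by transfer simp
  show "dist x y \<le> dist x z + dist y z" by transfer (rule dist_triangle2)
qed (simp_all add: uniformity_unit_interval_def open_unit_interval_def)

end

lemma real_of_ui_bounds [simp]: "0 \<le> real_of_ui x" "real_of_ui x \<le> 1"
  using real_of_ui[of x] by auto

lemma continuous_on_real_of_ui_UNIV: "continuous_on UNIV real_of_ui"
  unfolding continuous_on_iff dist_unit_interval.rep_eq by blast

lemma continuous_on_real_of_ui [continuous_intros]:
  "continuous_on A f \<Longrightarrow> continuous_on A (\<lambda>x. real_of_ui (f x))"
  by (rule continuous_on_compose2[OF continuous_on_real_of_ui_UNIV]) auto

instance unit_interval :: compact_metric_space
proof
  have "continuous_on {0..1} ui_of_real"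
    unfolding continuous_on_iff dist_unit_interval.rep_eq
    by (auto simp: ui_of_real_inverse)
  then have "compact (ui_of_real ` {0..1})"
    by (intro compact_continuous_image) auto
  moreover have "ui_of_real ` {0..1} = UNIV"
    by (metis image_eqI real_of_ui real_of_ui_inverse UNIV_eq_I)
  ultimately show "compact (UNIV :: unit_interval set)" by simp
qed

instance vec :: (compact_metric_space, finite) compact_metric_space
proof
  have "compact_space (euclidean :: 'a topology)"
    using compact_UNIV[where 'a='a] by (simp add: compact_space_def)
  then have "compact_space (product_topology (\<lambda>_ :: 'b. euclidean :: 'a topology) UNIV)"
    by (simp add: compact_space_product_topology)
  then have "compact (UNIV :: ('b \<Rightarrow> 'a) set)"
    by (simp add: euclidean_product_topology compact_space_def)
  moreover have "continuous_on UNIV (vec_lambda :: ('b \<Rightarrow> 'a) \<Rightarrow> 'a ^ 'b)"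
    by (intro continuous_on_vec_lambda continuous_on_product_coordinates)
  ultimately have "compact (range (vec_lambda :: ('b \<Rightarrow> 'a) \<Rightarrow> 'a ^ 'b))"
    by (intro compact_continuous_image)
  moreover have "range (vec_lambda :: ('b \<Rightarrow> 'a) \<Rightarrow> 'a ^ 'b) = UNIV"
    by (metis surjI vec_lambda_eta)
  ultimately show "compact (UNIV :: ('a ^ 'b) set)" by simp
qed

section \<open>Means and random means\<close>

type_synonym 'p cube = "unit_interval ^ 'p"

definition means :: "('p::finite cube \<Rightarrow>\<^sub>C real) set" where
  "means = {m :: 'p cube \<Rightarrow>\<^sub>C real. \<forall>x. Min (range (\<lambda>i. real_of_ui (x $ i))) \<le> m x
                 \<and> m x \<le> Max (range (\<lambda>i. real_of_ui (x $ i)))}"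

text \<open>The type \<^typ>\<open>'e\<close> plays the role of $d$-dimensional Euclidean space; for
  $d = 1$ it is \<^typ>\<open>real\<close>.\<close>

definition random_mean ::
  "'a measure \<Rightarrow> ('a \<Rightarrow> 'e::euclidean_space) \<Rightarrow> ('a \<Rightarrow> ('p::finite cube \<Rightarrow>\<^sub>C real)) \<Rightarrow> bool" where
  "random_mean P \<xi> M \<longleftrightarrow>
     prob_space P \<and> \<xi> \<in> borel_measurable P \<and>
     M \<in> space P \<rightarrow> means \<and>
     M \<in> borel_measurable P \<and>
     (\<exists>M\<xi> :: 'p cube \<times> 'e \<Rightarrow> unit_interval.
        M\<xi> \<in> measurable (borel \<Otimes>\<^sub>M borel) borel \<and>
        (\<forall>\<omega>\<in>space P. continuous_on UNIV (\<lambda>x. real_of_ui (M\<xi> (x, \<xi> \<omega>)))) \<and>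
        measure P {\<omega> \<in> space P. \<forall>x. M \<omega> x = real_of_ui (M\<xi> (x, \<xi> \<omega>))} = 1)"

text \<open>The expected value is the library's Bochner integral in the Banach space of continuous
  functions on the cube.\<close>

definition kappa ::
  "'a measure \<Rightarrow> (nat \<Rightarrow> 'a \<Rightarrow> ('p::finite cube \<Rightarrow>\<^sub>C real)) \<Rightarrow> nat \<Rightarrow> 'a \<Rightarrow> real" where
  "kappa P M n \<omega> =
     (SUP x. \<bar>(1 / real n) * (\<Sum>j=1..n. M j \<omega> x) - (integral\<^sup>L P (M 1)) x\<bar>)"

text \<open>Convergence in distribution of real random variables to a limit law. Measurability is
  demanded explicitly because \<^const>\<open>distr\<close> is meaningless for a non-measurable map.\<close>

definition converges_in_distribution ::
  "'a measure \<Rightarrow> (nat \<Rightarrow> 'a \<Rightarrow> real) \<Rightarrow> real measure \<Rightarrow> bool" where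
  "converges_in_distribution P X L \<longleftrightarrow>
     (\<forall>n. X n \<in> borel_measurable P) \<and> weak_conv_m (\<lambda>n. distr P borel (X n)) L"

section \<open>The random choice between the arithmetic and the geometric mean\<close>

definition arith_mean :: "2 cube \<Rightarrow>\<^sub>C real" where
  "arith_mean = Bcontfun (\<lambda>x. (real_of_ui (x $ 1) + real_of_ui (x $ 2)) / 2)"

definition geom_mean :: "2 cube \<Rightarrow>\<^sub>C real" where
  "geom_mean = Bcontfun (\<lambda>x. sqrt (real_of_ui (x $ 1) * real_of_ui (x $ 2)))"

lemma apply_arith_mean: "arith_mean x = (real_of_ui (x $ 1) + real_of_ui (x $ 2)) / 2"
  unfolding arith_mean_def
  by (subst Bcontfun_inverse) (auto simp: bcontfun_compact_iff intro!: continuous_intros)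

lemma apply_geom_mean: "geom_mean x = sqrt (real_of_ui (x $ 1) * real_of_ui (x $ 2))"
  unfolding geom_mean_def
  by (subst Bcontfun_inverse) (auto simp: bcontfun_compact_iff intro!: continuous_intros)

definition arith_geom :: "(nat \<Rightarrow> 'a \<Rightarrow> real) \<Rightarrow> nat \<Rightarrow> 'a \<Rightarrow> (2 cube \<Rightarrow>\<^sub>C real)" where
  "arith_geom \<xi> n \<omega> =
     indicator {\<omega>. \<xi> n \<omega> = 0} \<omega> *\<^sub>R arith_mean + indicator {\<omega>. \<xi> n \<omega> = 1} \<omega> *\<^sub>R geom_mean"

lemma apply_arith_geom:
  "arith_geom \<xi> n \<omega> x =
     (real_of_ui (x $ 1) + real_of_ui (x $ 2)) / 2 * indicator {\<omega>. \<xi> n \<omega> = 0} \<omega> +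
     sqrt (real_of_ui (x $ 1) * real_of_ui (x $ 2)) * indicator {\<omega>. \<xi> n \<omega> = 1} \<omega>"
  by (simp add: arith_geom_def apply_arith_mean apply_geom_mean)

end

theory Submission
  imports Defs
begin

text \<open>
  With $B_j = \mathbf 1_{\{\xi_j = 0\}}$ one has $M_j = m_1 + B_j (m_0 - m_1)$, so that the centred
  average of the $M_j$ is the scalar $\frac1n\sum_j B_j - q$ times the fixed function $m_0 - m_1$,
  whose supremum norm is $1/2$, attained at $(1, 0)$. Hence
  $\kappa_n = \frac12 \bigl|\frac1n\sum_j B_j - q\bigr|$ and everything reduces to Bernoulli variables:
  the almost sure convergence follows from Hoeffding's inequality and the Borel-Cantelli lemma,
  the distributional limit from the central limit theorem and continuous mapping.
\<close>

section \<open>Tools from probability theory\<close>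

lemma (in prob_space) indep_vars_reindex:
  assumes "inj_on h I" "indep_vars M' X (h ` I)"
  shows "indep_vars (\<lambda>i. M' (h i)) (\<lambda>i. X (h i)) I"
proof -
  have rv: "\<And>i. i \<in> I \<Longrightarrow> random_variable (M' (h i)) (X (h i))"
    and ind: "indep_sets (\<lambda>i. {X i -` A \<inter> space M |A. A \<in> sets (M' i)}) (h ` I)"
    using assms(2) unfolding indep_vars_def2 by auto
  have "prob (\<Inter>j\<in>J. A j) = (\<Prod>j\<in>J. prob (A j))"
    if J: "J \<subseteq> I" "J \<noteq> {}" "finite J"
      and A: "\<forall>j\<in>J. A j \<in> {X (h j) -` A \<inter> space M |A. A \<in> sets (M' (h j))}" for J A
  proof -
    have inj: "inj_on h J"
      using assms(1) J(1) inj_on_subset by blast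
    have "prob (\<Inter>j\<in>h ` J. A (the_inv_into J h j)) = (\<Prod>j\<in>h ` J. prob (A (the_inv_into J h j)))"
      by (rule indep_setsD[OF ind]) (use J A in \<open>auto simp: the_inv_into_f_f[OF inj]\<close>)
    then show ?thesis
      by (simp add: the_inv_into_f_f[OF inj] prod.reindex[OF inj])
  qed
  moreover have "{X (h i) -` A \<inter> space M |A. A \<in> sets (M' (h i))} \<subseteq> events" if "i \<in> I" for i
    using rv[OF that] by (auto intro: measurable_sets)
  ultimately show ?thesis
    unfolding indep_vars_def2 by (intro conjI ballI rv indep_setsI) assumption+
qed

text \<open>For bounded variables Hoeffding's bound on a deviation of size e decays geometrically in
  n, hence is summable, and Borel-Cantelli excludes infinitely many such deviations.\<close>

lemma (in prob_space) bounded_strong_law_of_large_numbers: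
  fixes X :: "nat \<Rightarrow> 'a \<Rightarrow> real" and Y :: "'a \<Rightarrow> real"
  assumes indep: "indep_vars (\<lambda>_. borel) X UNIV"
    and distr: "\<And>i. distr M borel (X i) = distr M borel Y"
    and [measurable]: "Y \<in> borel_measurable M"
    and bounded: "AE \<omega> in M. Y \<omega> \<in> {a..b}"
    and "a < b"
  shows "AE \<omega> in M. (\<lambda>n. (\<Sum>i<n. X i \<omega>) / real n) \<longlonglongrightarrow> expectation Y"
proof -
  have [measurable]: "X i \<in> borel_measurable M" for i
    using indep by (auto simp: indep_vars_def)
  let ?Z = "\<lambda>n \<omega>. \<bar>(\<Sum>i<n. X i \<omega>) / real n - expectation Y\<bar>"
  have small: "AE \<omega> in M. eventually (\<lambda>n. ?Z n \<omega> < e) sequentially" if "e > 0" for e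
  proof -
    let ?r = "exp (- (2 * e\<^sup>2 / (b - a)\<^sup>2))"
    have bound: "prob {\<omega>\<in>space M. ?Z n \<omega> \<ge> e} \<le> 2 * ?r ^ n" for n
    proof (cases "n = 0")
      case True
      \<comment> \<open>Hoeffding's inequality needs a nonempty index set; for n = 0 the bound is 2,
        which exceeds any probability.\<close>
      then show ?thesis using order.trans[OF prob_le_1, of 2] by simp
    next
      case False
      interpret Hoeffding_ineq_iid M "{..<n}" X Y a b "expectation Y"
      proof unfold_locales
        show "indep_vars (\<lambda>_. borel) X {..<n}"
          by (rule indep_vars_subset[OF indep]) simp
        show "distr M borel (X i) = distr M borel Y" for i
          by (rule distr)
      qed (use bounded in auto)
      have "prob {\<omega>\<in>space M. ?Z n \<omega> \<ge> e} \<le> 2 * exp (-2 * real n * e\<^sup>2 / (b - a)\<^sup>2)"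
        using Hoeffding_ineq_abs_ge'[of e] that \<open>a < b\<close> False by (simp add: lessThan_empty_iff)
      also have "-2 * real n * e\<^sup>2 / (b - a)\<^sup>2 = real n * - (2 * e\<^sup>2 / (b - a)\<^sup>2)"
        by simp
      also have "exp \<dots> = ?r ^ n"
        by (rule exp_of_nat_mult)
      finally show ?thesis .
    qed
    have "AE \<omega> in M. eventually (\<lambda>n. \<omega> \<in> space M - {\<omega>\<in>space M. ?Z n \<omega> \<ge> e}) sequentially"
    proof (rule borel_cantelli_AE1)
      have "norm ?r < 1"
        using that \<open>a < b\<close> by simp
      then have "summable (\<lambda>n. 2 * ?r ^ n)"
        by (intro summable_mult summable_geometric)
      then show "summable (\<lambda>n. prob {\<omega>\<in>space M. ?Z n \<omega> \<ge> e})"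
        by (rule summable_comparison_test') (simp add: bound)
    qed (auto simp: emeasure_eq_measure)
    then show ?thesis
      by eventually_elim (erule eventually_mono, simp add: not_le)
  qed
  \<comment> \<open>Countably many tolerances 1/(k+1) suffice, so the exceptional null sets can be
    united.\<close>
  have "AE \<omega> in M. \<forall>k. eventually (\<lambda>n. ?Z n \<omega> < inverse (real (Suc k))) sequentially"
    unfolding AE_all_countable by (intro allI small) simp
  then show ?thesis
  proof (rule AE_mp, intro AE_I2 impI)
    fix \<omega> assume *: "\<forall>k. eventually (\<lambda>n. ?Z n \<omega> < inverse (real (Suc k))) sequentially"
    show "(\<lambda>n. (\<Sum>i<n. X i \<omega>) / real n) \<longlonglongrightarrow> expectation Y"
    proof (rule tendstoI)
      fix e :: real assume "0 < e"
      then obtain k where "inverse (real (Suc k)) < e"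
        using reals_Archimedean by blast
      then show "\<forall>\<^sub>F n in sequentially. dist ((\<Sum>i<n. X i \<omega>) / real n) (expectation Y) < e"
        unfolding dist_real_def using *[rule_format, of k] by (auto elim!: eventually_mono)
    qed
  qed
qed

text \<open>Continuous mapping theorem: weak convergence is tested on bounded continuous
  \<open>f\<close>, and \<open>f\<close> composed with \<open>g\<close> is again such a test
  function.\<close>

lemma weak_conv_m_distr_continuous:
  fixes g :: "real \<Rightarrow> real"
  assumes "\<And>n. real_distribution (\<mu> n)" "real_distribution \<nu>" "weak_conv_m \<mu> \<nu>"
    and "continuous_on UNIV g"
  shows "weak_conv_m (\<lambda>n. distr (\<mu> n) borel g) (distr \<nu> borel g)"
proof -
  have [measurable]: "g \<in> borel_measurable borel"
    using assms(4) by (rule borel_measurable_continuous_onI)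
  have dist: "real_distribution (distr N borel g)" if "real_distribution N" for N
  proof -
    interpret real_distribution N by fact
    show ?thesis by (rule real_distribution_distr) simp
  qed
  show ?thesis
  proof (rule integral_bdd_continuous_conv_imp_weak_conv[OF dist[OF assms(1)] dist[OF assms(2)]])
    fix f :: "real \<Rightarrow> real" assume f: "\<And>x. isCont f x" "\<And>x. \<bar>f x\<bar> \<le> 1"
    have [measurable]: "f \<in> borel_measurable borel"
      using f(1) by (intro borel_measurable_continuous_onI continuous_at_imp_continuous_on) auto
    have [measurable_cong]: "sets (\<mu> n) = sets borel" "sets \<nu> = sets borel" for n
      using assms(1,2) by (auto simp: real_distribution_def real_distribution_axioms_def)
    have "isCont (\<lambda>x. f (g x)) x" for x
      using assms(4) f(1) by (intro isCont_o2[of x g f]) (auto simp: continuous_on_eq_continuous_at)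
    then have "(\<lambda>n. integral\<^sup>L (\<mu> n) (\<lambda>x. f (g x))) \<longlonglongrightarrow> integral\<^sup>L \<nu> (\<lambda>x. f (g x))"
      using f(2) by (intro weak_conv_imp_integral_bdd_continuous_conv[OF assms(1-3), where B = 1]) auto
    then show "(\<lambda>n. integral\<^sup>L (distr (\<mu> n) borel g) f) \<longlonglongrightarrow> integral\<^sup>L (distr \<nu> borel g) f"
      by (simp add: integral_distr)
  qed
qed

text \<open>Converts the standard normal limit of the central limit theorem into the law with
  variance \<sigma>^2.\<close>

lemma distr_scale_std_normal:
  assumes "0 < \<sigma>"
  shows "distr std_normal_distribution borel (\<lambda>x. \<sigma> * x) = density lborel (normal_density 0 \<sigma>)"
proof -
  interpret prob_space std_normal_distribution
    by (rule prob_space_normal_density) simp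
  have "distributed std_normal_distribution lborel (\<lambda>x. x) std_normal_density"
    by (auto simp: distributed_def distr_id2)
  then have "distributed std_normal_distribution lborel (\<lambda>x. 0 + \<sigma> * x)
      (normal_density (0 + \<sigma> * 0) (\<bar>\<sigma>\<bar> * 1))"
    using assms by (intro normal_density_affine) auto
  then have "distr std_normal_distribution lborel (\<lambda>x. \<sigma> * x) = density lborel (normal_density 0 \<sigma>)"
    using assms by (simp add: distributed_distr_eq_density)
  \<comment> \<open>\<open>lborel\<close> and \<open>borel\<close> have the same measurable sets, so
    as a target of \<open>distr\<close> they are interchangeable.\<close>
  then show ?thesis
    by (simp cong: distr_cong)
qed

section \<open>The gap between the arithmetic and the geometric mean\<close>

text \<open>Expanding 0 \<le> (1-x)(1-y) + xy gives (x+y)/2 \<le> 1/2 + xy, and xy \<le> sqrt(xy)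
  because xy lies in [0,1].\<close>

lemma arith_geom_gap_le_half:
  fixes x y :: real
  assumes "x \<in> {0..1}" "y \<in> {0..1}"
  shows "(x + y) / 2 - sqrt (x * y) \<le> 1 / 2"
proof -
  have "0 \<le> (1 - x) * (1 - y) + x * y"
    using assms by (intro add_nonneg_nonneg mult_nonneg_nonneg) auto
  moreover have "x * y \<le> sqrt (x * y)"
    using assms by (intro real_le_rsqrt) (auto simp: power2_eq_square mult_le_one intro!: mult_left_le)
  ultimately show ?thesis
    by (simp add: algebra_simps)
qed

lemma Sup_arith_geom_gap:
  "(SUP (x, y) \<in> {0..1} \<times> {0..1}. (x + y) / 2 - sqrt (x * y)) = (1 / 2 :: real)"
  by (rule cSup_eq_maximum)
     (use arith_geom_gap_le_half in \<open>force intro: image_eqI[of _ _ "(1, 0)"]\<close>)+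

text \<open>Evaluates \<open>kappa\<close> once the centred average is known to be a scalar
  \<open>c\<close> times the gap.\<close>

lemma Sup_cube_arith_geom_gap:
  "(SUP x. \<bar>c * (arith_mean x - geom_mean x)\<bar>) = \<bar>c\<bar> / 2"
proof (rule cSup_eq_maximum)
  define e :: "2 cube" where "e = (\<chi> i. if i = 1 then ui_of_real 1 else ui_of_real 0)"
  have "arith_mean e - geom_mean e = 1 / 2"
    by (simp add: e_def apply_arith_mean apply_geom_mean ui_of_real_inverse)
  then show "\<bar>c\<bar> / 2 \<in> range (\<lambda>x. \<bar>c * (arith_mean x - geom_mean x)\<bar>)"
    by (intro image_eqI[of _ _ e]) (auto simp: abs_mult)
next
  fix z assume "z \<in> range (\<lambda>x. \<bar>c * (arith_mean x - geom_mean x)\<bar>)"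
  then obtain x where z: "z = \<bar>c\<bar> * \<bar>arith_mean x - geom_mean x\<bar>"
    by (auto simp: abs_mult)
  have "0 \<le> arith_mean x - geom_mean x" "arith_mean x - geom_mean x \<le> 1 / 2"
    using arith_geo_mean_sqrt[of "real_of_ui (x $ 1)" "real_of_ui (x $ 2)"]
      arith_geom_gap_le_half[of "real_of_ui (x $ 1)" "real_of_ui (x $ 2)"]
    by (simp_all add: apply_arith_mean apply_geom_mean)
  then have "\<bar>arith_mean x - geom_mean x\<bar> \<le> 1 / 2"
    by simp
  then show "z \<le> \<bar>c\<bar> / 2"
    using mult_left_mono[of "\<bar>arith_mean x - geom_mean x\<bar>" "1 / 2" "\<bar>c\<bar>"] z by simp
qed

section \<open>Measurability and random means\<close>

text \<open>\<open>unit_interval\<close> carries the metric of the reals, and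
  \<open>ui_of_real\<close> preserves distances on [0,1]; the range condition keeps \<open>f\<close>
  there.\<close>

lemma borel_measurable_ui_of_real:
  assumes "continuous_on UNIV f" "\<And>x. f x \<in> {0..1}"
  shows "(\<lambda>x. ui_of_real (f x)) \<in> borel_measurable borel"
proof (rule borel_measurable_continuous_onI)
  show "continuous_on UNIV (\<lambda>x. ui_of_real (f x))"
    using assms unfolding continuous_on_def tendsto_iff dist_unit_interval.rep_eq
    by (simp add: ui_of_real_inverse)
qed

lemma arith_mean_in_means: "arith_mean \<in> means"
  by (auto simp: means_def apply_arith_mean UNIV_2 min_def max_def)

lemma geom_mean_in_means: "geom_mean \<in> means"
proof -
  \<comment> \<open>Squaring reduces both bounds to min^2 \<le> ab \<le> max^2.\<close>
  have "min a b \<le> sqrt (a * b) \<and> sqrt (a * b) \<le> max a b" if "0 \<le> a" "0 \<le> b" for a b :: real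
  proof
    show "min a b \<le> sqrt (a * b)"
      using that by (intro real_le_rsqrt) (auto simp: power2_eq_square min_def intro: mult_mono)
    show "sqrt (a * b) \<le> max a b"
      using that by (intro real_le_lsqrt) (auto simp: power2_eq_square max_def intro: mult_mono)
  qed
  then show ?thesis
    by (simp add: means_def apply_geom_mean UNIV_2)
qed

lemma means_in_unit_interval:
  assumes "m \<in> means"
  shows "m x \<in> {0..1}"
proof -
  have "0 \<le> Min (range (\<lambda>i. real_of_ui (x $ i)))" "Max (range (\<lambda>i. real_of_ui (x $ i))) \<le> 1"
    by auto
  moreover have "Min (range (\<lambda>i. real_of_ui (x $ i))) \<le> m x"
      "m x \<le> Max (range (\<lambda>i. real_of_ui (x $ i)))"
    using assms by (auto simp: means_def)
  ultimately show ?thesis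
    unfolding atLeastAtMost_iff by linarith
qed

text \<open>The generating map is \<open>m0\<close> on t = 0 and \<open>m1\<close> elsewhere. Each
  section in x is one of two continuous means, and it reproduces \<open>M\<close> on all of
  \<open>space P\<close>, not only almost surely.\<close>

lemma random_mean_choice:
  fixes M :: "'a \<Rightarrow> ('p::finite cube \<Rightarrow>\<^sub>C real)" and \<zeta> :: "'a \<Rightarrow> real"
  assumes "prob_space P" and [measurable]: "\<zeta> \<in> borel_measurable P"
    and means: "m0 \<in> means" "m1 \<in> means"
    and M: "\<And>\<omega>. \<omega> \<in> space P \<Longrightarrow> M \<omega> = (if \<zeta> \<omega> = 0 then m0 else m1)"
  shows "random_mean P \<zeta> M"
proof -
  interpret prob_space P by fact
  define F where "F = (\<lambda>(x :: 'p cube, t :: real). ui_of_real (if t = 0 then m0 x else m1 x))"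
  have F: "real_of_ui (F (x, t)) = (if t = 0 then m0 x else m1 x)" for x t
    using means_in_unit_interval[OF means(1), of x] means_in_unit_interval[OF means(2), of x]
    by (simp add: F_def ui_of_real_inverse)
  have "(\<lambda>x. ui_of_real (m x)) \<in> borel_measurable borel" if "m \<in> means"
    for m :: "'p cube \<Rightarrow>\<^sub>C real"
    by (intro borel_measurable_ui_of_real means_in_unit_interval that) auto
  note m = this[OF means(1), THEN measurable_compose[OF measurable_fst]]
    this[OF means(2), THEN measurable_compose[OF measurable_fst]]
  \<comment> \<open>Each branch depends on the first coordinate only and the test on the second
    only, which gives measurability for the product \<sigma>-algebra.\<close>
  have "(\<lambda>p :: 'p cube \<times> real. if snd p = 0 then ui_of_real (m0 (fst p)) else ui_of_real (m1 (fst p)))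
      \<in> borel \<Otimes>\<^sub>M borel \<rightarrow>\<^sub>M borel"
    using borel_measurable_eq[OF measurable_snd borel_measurable_const]
    by (intro measurable_If[OF m]) simp
  moreover have "F = (\<lambda>p :: 'p cube \<times> real. if snd p = 0 then ui_of_real (m0 (fst p)) else ui_of_real (m1 (fst p)))"
    by (auto simp: F_def)
  ultimately have "F \<in> borel \<Otimes>\<^sub>M borel \<rightarrow>\<^sub>M borel"
    by simp
  moreover have "continuous_on UNIV (\<lambda>x. real_of_ui (F (x, t)))" for t
    by (cases "t = 0") (simp_all add: F)
  moreover have "{\<omega> \<in> space P. \<forall>x. M \<omega> x = real_of_ui (F (x, \<zeta> \<omega>))} = space P"
    by (auto simp: M F)
  moreover have "M \<in> borel_measurable P"
    by (subst measurable_cong[OF M]) measurable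
  moreover have "M \<in> space P \<rightarrow> means"
    using means by (auto simp: M)
  ultimately show ?thesis
    unfolding random_mean_def using assms(1,2) prob_space by auto
qed

theorem corollary3p2:
  fixes P :: "'a measure" and \<xi> :: "nat \<Rightarrow> 'a \<Rightarrow> real" and q :: real
  assumes "prob_space P"
    and "0 < q" and "q < 1"
    and "prob_space.indep_vars P (\<lambda>_. borel) \<xi> {1..}"
    and "\<And>n. n \<ge> 1 \<Longrightarrow> distr P borel (\<xi> n) = distr P borel (\<xi> 1)"
    and "\<And>n \<omega>. n \<ge> 1 \<Longrightarrow> \<omega> \<in> space P \<Longrightarrow> \<xi> n \<omega> \<in> {0, 1}"
    and "measure P {\<omega> \<in> space P. \<xi> 1 \<omega> = 0} = q"
    and "measure P {\<omega> \<in> space P. \<xi> 1 \<omega> = 1} = 1 - q"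
  shows "(\<forall>n\<ge>1. random_mean P (\<xi> n) (arith_geom \<xi> n))
    \<and> integrable P (arith_geom \<xi> 1)
    \<and> (\<forall>x. (integral\<^sup>L P (arith_geom \<xi> 1)) x =
          (real_of_ui (x $ 1) + real_of_ui (x $ 2)) / 2 * q
          + sqrt (real_of_ui (x $ 1) * real_of_ui (x $ 2)) * (1 - q))
    \<and> measure P {\<omega> \<in> space P. (\<lambda>n. kappa P (arith_geom \<xi>) n \<omega>) \<longlonglongrightarrow> 0} = 1
    \<and> converges_in_distribution P (\<lambda>n \<omega>. sqrt (real n) * kappa P (arith_geom \<xi>) n \<omega>)
        (distr (density lborel (normal_density 0 (sqrt (q * (1 - q))))) borel
          (\<lambda>z. (SUP (x1, x2) \<in> {0..1} \<times> {0..1}. (x1 + x2) / 2 - sqrt (x1 * x2)) * \<bar>z\<bar>))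
    \<and> (SUP (x1 :: real, x2) \<in> {0..1} \<times> {0..1}. (x1 + x2) / 2 - sqrt (x1 * x2)) = 1 / 2"
proof -

  \<comment> \<open>The Bernoulli indicators\<close>
  interpret prob_space P by fact
  have \<xi>_meas: "\<xi> n \<in> borel_measurable P" if "n \<ge> 1" for n
    using assms(4) that by (auto simp: indep_vars_def)
  \<comment> \<open>The shift by \<open>Suc\<close> turns sums over 1..n into sums over i < n; the
    indicator of 0 makes q the success probability.\<close>
  define B :: "nat \<Rightarrow> 'a \<Rightarrow> real" where "B = (\<lambda>i \<omega>. indicator {0} (\<xi> (Suc i) \<omega>))"
  define \<sigma> where "\<sigma> = sqrt (q * (1 - q))"
  have "0 < \<sigma>" and \<sigma>2: "\<sigma>\<^sup>2 = q * (1 - q)"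
    using assms(2,3) by (simp_all add: \<sigma>_def)
  have B_meas [measurable]: "B i \<in> borel_measurable P" for i
    unfolding B_def
    by (rule measurable_compose[OF \<xi>_meas[of "Suc i"] borel_measurable_indicator]) auto
  have B_int [simp]: "integrable P (B i)" for i
    by (rule integrable_const_bound[of _ 1, OF AE_I2 B_meas]) (simp add: B_def indicator_def)
  have "indep_vars (\<lambda>_. borel) (\<lambda>i. \<xi> (Suc i)) UNIV"
    using indep_vars_reindex[of Suc UNIV "\<lambda>_. borel" \<xi>]
      indep_vars_subset[OF assms(4), of "range Suc"] by auto
  then have B_indep: "indep_vars (\<lambda>_. borel) B UNIV"
    unfolding B_def by (rule indep_vars_compose2) auto
  have B_distr: "distr P borel (B i) = distr P borel (B 0)" for i
  proof -
    have "distr P borel (B i) = distr (distr P borel (\<xi> (Suc i))) borel (indicator {0})" for i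
      using \<xi>_meas[of "Suc i"] by (subst distr_distr) (auto simp: B_def comp_def)
    then show ?thesis
      using assms(5)[of "Suc i"] by simp
  qed
  have "B 0 \<omega> = indicator {\<omega> \<in> space P. \<xi> 1 \<omega> = 0} \<omega>" if "\<omega> \<in> space P" for \<omega>
    using that by (simp add: B_def indicator_def)
  then have "expectation (B 0) = prob ({\<omega> \<in> space P. \<xi> 1 \<omega> = 0} \<inter> space P)"
    by (simp cong: Bochner_Integration.integral_cong)
  also have "{\<omega> \<in> space P. \<xi> 1 \<omega> = 0} \<inter> space P = {\<omega> \<in> space P. \<xi> 1 \<omega> = 0}"
    by blast
  finally have B0_exp: "expectation (B 0) = q"
    by (simp only: assms(7))
  have B_exp: "expectation (B i) = q" for i
    using B0_exp B_distr[of i] integral_distr[OF B_meas[of i], of "\<lambda>x. x"]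
      integral_distr[OF B_meas[of 0], of "\<lambda>x. x"] by simp
  \<comment> \<open>Idempotence gives the variance q - q^2 and, for the central limit theorem,
    square integrability.\<close>
  have B_sq: "(B i \<omega>)\<^sup>2 = B i \<omega>" for i \<omega>
    by (simp add: B_def indicator_def)
  have B_var: "variance (B i) = \<sigma>\<^sup>2" for i
    by (subst variance_eq) (simp_all add: B_sq B_exp \<sigma>2, simp add: power2_eq_square algebra_simps)

  \<comment> \<open>Random means and the expected value\<close>
  have mean_eq: "arith_geom \<xi> (Suc i) \<omega> = geom_mean + B i \<omega> *\<^sub>R (arith_mean - geom_mean)"
    if "\<omega> \<in> space P" for i \<omega>
    \<comment> \<open>Only the values 0 and 1 occur, so the indicator of 1 is 1 -
      \<open>B i\<close>.\<close>
    using assms(6)[of "Suc i" \<omega>] that by (auto simp: arith_geom_def B_def)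
  have rm: "random_mean P (\<xi> n) (arith_geom \<xi> n)" if "n \<ge> 1" for n
  proof (rule random_mean_choice[OF assms(1) \<xi>_meas arith_mean_in_means geom_mean_in_means])
    fix \<omega> assume "\<omega> \<in> space P"
    then show "arith_geom \<xi> n \<omega> = (if \<xi> n \<omega> = 0 then arith_mean else geom_mean)"
      using assms(6)[of n \<omega>] that by (auto simp: arith_geom_def)
  qed fact+
  have \<xi>_level: "{\<omega> \<in> space P. \<xi> 1 \<omega> = c} \<in> events" for c
    using borel_measurable_eq[OF \<xi>_meas[of 1] borel_measurable_const[of c]] by simp
  \<comment> \<open>The integrand takes only two values in the Banach space; its indicators are cut
    down to \<open>space P\<close> so that they are events.\<close>
  have "has_bochner_integral P (\<lambda>\<omega>. indicator {\<omega> \<in> space P. \<xi> 1 \<omega> = 0} \<omega> *\<^sub>R arith_mean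
        + indicator {\<omega> \<in> space P. \<xi> 1 \<omega> = 1} \<omega> *\<^sub>R geom_mean)
      (q *\<^sub>R arith_mean + (1 - q) *\<^sub>R geom_mean)"
    using has_bochner_integral_add[OF has_bochner_integral_indicator[OF \<xi>_level[of 0]]
        has_bochner_integral_indicator[OF \<xi>_level[of 1]]]
    by (simp add: assms(7,8)[simplified] emeasure_eq_measure)
  then have bochner: "has_bochner_integral P (arith_geom \<xi> 1) (q *\<^sub>R arith_mean + (1 - q) *\<^sub>R geom_mean)"
    by (rule has_bochner_integral_cong[THEN iffD1, rotated -1])
      (auto simp: arith_geom_def indicator_def)
  then have int: "integrable P (arith_geom \<xi> 1)"
    and mean: "integral\<^sup>L P (arith_geom \<xi> 1) = q *\<^sub>R arith_mean + (1 - q) *\<^sub>R geom_mean"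
    by (auto dest: has_bochner_integral_integral_eq simp: integrable.simps)

  \<comment> \<open>Closed form of \<open>kappa\<close> and the strong law\<close>
  have kappa_eq: "kappa P (arith_geom \<xi>) n \<omega> = \<bar>(\<Sum>i<n. B i \<omega>) / real n - q\<bar> / 2"
    if "n > 0" "\<omega> \<in> space P" for n \<omega>
  proof -
    have "(1 / real n) * (\<Sum>j=1..n. arith_geom \<xi> j \<omega> x) - (integral\<^sup>L P (arith_geom \<xi> 1)) x
        = ((\<Sum>i<n. B i \<omega>) / real n - q) * (arith_mean x - geom_mean x)" for x
    proof -
      have "(\<Sum>j=1..n. arith_geom \<xi> j \<omega> x) = (\<Sum>i<n. arith_geom \<xi> (Suc i) \<omega> x)"
        by (simp add: sum.atLeast1_atMost_eq)
      also have "\<dots> = real n * geom_mean x + (\<Sum>i<n. B i \<omega>) * (arith_mean x - geom_mean x)"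
        using that by (simp add: mean_eq sum.distrib sum_distrib_right)
      finally show ?thesis
        unfolding mean using that by (simp add: field_simps)
    qed
    then show ?thesis
      by (simp only: kappa_def Sup_cube_arith_geom_gap)
  qed

  have kappa_lim: "(\<lambda>n. kappa P (arith_geom \<xi>) n \<omega>) \<longlonglongrightarrow> 0 \<longleftrightarrow> (\<lambda>n. (\<Sum>i<n. B i \<omega>) / real n) \<longlonglongrightarrow> q"
    if "\<omega> \<in> space P" for \<omega>
  proof -
    have "(\<lambda>n. kappa P (arith_geom \<xi>) n \<omega>) \<longlonglongrightarrow> 0
        \<longleftrightarrow> (\<lambda>n. \<bar>(\<Sum>i<n. B i \<omega>) / real n - q\<bar> / 2) \<longlonglongrightarrow> 0"
      \<comment> \<open>The closed form fails at n = 0, where \<open>kappa\<close> is the supremum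
        of E(M_1), namely 1, and the right side is q/2; a limit ignores this index.\<close>
      using that by (intro tendsto_cong eventually_mono[OF eventually_gt_at_top[of 0]]) (rule kappa_eq)
    then show ?thesis
      by (simp add: tendsto_rabs_zero_iff LIM_zero_iff)
  qed
  have "AE \<omega> in P. (\<lambda>n. (\<Sum>i<n. B i \<omega>) / real n) \<longlonglongrightarrow> q"
    using bounded_strong_law_of_large_numbers[OF B_indep B_distr B_meas, of 0 1] B0_exp
    by (simp add: B_def indicator_def)
  then have "prob {\<omega> \<in> space P. (\<lambda>n. (\<Sum>i<n. B i \<omega>) / real n) \<longlonglongrightarrow> q} = 1"
    by (subst prob_Collect_eq_1) simp_all
  then have lln: "prob {\<omega> \<in> space P. (\<lambda>n. kappa P (arith_geom \<xi>) n \<omega>) \<longlonglongrightarrow> 0} = 1"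
    by (simp add: kappa_lim cong: conj_cong)

  \<comment> \<open>The distributional limit\<close>
  let ?S = "\<lambda>n \<omega>. (\<Sum>i<n. B i \<omega> - q) / sqrt (real n * \<sigma>\<^sup>2)"
  \<comment> \<open>This holds for every n: at n = 0 both sides vanish. Otherwise n is split as sqrt
    n * sqrt n and one factor cancels.\<close>
  have scaled: "sqrt (real n) * kappa P (arith_geom \<xi>) n \<omega> = \<bar>\<sigma> * ?S n \<omega>\<bar> / 2"
    if "\<omega> \<in> space P" for n \<omega>
  proof (cases "n = 0")
    case False
    then have "(\<Sum>i<n. B i \<omega>) / real n - q = (\<Sum>i<n. B i \<omega> - q) / (sqrt (real n) * sqrt (real n))"
      by (simp add: sum_subtractf field_simps)
    then have "kappa P (arith_geom \<xi>) n \<omega> = \<bar>(\<Sum>i<n. B i \<omega> - q) / (sqrt (real n) * sqrt (real n))\<bar> / 2"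
      using False that by (simp only: kappa_eq)
    then show ?thesis
      using False \<open>0 < \<sigma>\<close> by (simp add: real_sqrt_mult abs_mult del: real_sqrt_mult_self)
  qed simp
  \<comment> \<open>The supremum in \<open>kappa\<close> is uncountable; measurability is read off
    from the closed form.\<close>
  have meas: "(\<lambda>\<omega>. sqrt (real n) * kappa P (arith_geom \<xi>) n \<omega>) \<in> borel_measurable P" for n
    by (subst measurable_cong[OF scaled]) measurable
  let ?g = "\<lambda>z :: real. \<bar>\<sigma> * z\<bar> / 2"
  have "weak_conv_m (\<lambda>n. distr P borel (?S n)) std_normal_distribution"
    by (rule central_limit_theorem[OF B_indep B_exp \<open>0 < \<sigma>\<close> _ B_var B_distr]) (simp add: B_sq)
  then have "weak_conv_m (\<lambda>n. distr (distr P borel (?S n)) borel ?g) (distr std_normal_distribution borel ?g)"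
    by (intro weak_conv_m_distr_continuous real_distribution_distr real_dist_normal_dist)
       (auto intro!: continuous_intros)
  moreover have "distr (distr P borel (?S n)) borel ?g
      = distr P borel (\<lambda>\<omega>. sqrt (real n) * kappa P (arith_geom \<xi>) n \<omega>)" for n
    by (subst distr_distr) (auto simp: scaled intro!: distr_cong)
  \<comment> \<open>The factor \<sigma> inside \<open>?g\<close> is absorbed into the normal law,
    leaving half the absolute value.\<close>
  moreover have "distr std_normal_distribution borel ?g
      = distr (density lborel (normal_density 0 \<sigma>)) borel (\<lambda>z. 1 / 2 * \<bar>z\<bar>)"
    by (subst distr_scale_std_normal[OF \<open>0 < \<sigma>\<close>, symmetric], subst distr_distr) (auto simp: comp_def)
  ultimately have clt: "converges_in_distribution P (\<lambda>n \<omega>. sqrt (real n) * kappa P (arith_geom \<xi>) n \<omega>)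
      (distr (density lborel (normal_density 0 \<sigma>)) borel (\<lambda>z. 1 / 2 * \<bar>z\<bar>))"
    using meas by (simp add: converges_in_distribution_def)
  have "(integral\<^sup>L P (arith_geom \<xi> 1)) x = (real_of_ui (x $ 1) + real_of_ui (x $ 2)) / 2 * q
      + sqrt (real_of_ui (x $ 1) * real_of_ui (x $ 2)) * (1 - q)" for x
    unfolding mean by (simp add: apply_arith_mean apply_geom_mean)
  then show ?thesis
    using rm int lln clt unfolding Sup_arith_geom_gap \<sigma>_def by simp
qed

end
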